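(* Let $\Phi(x)=d(x,[0,1])^3$ for $x\in\mathbb{R}$, where $d(x,[0,1])$ is the distance from $x$ to $[0,1]$, and for $N>0$ let $v=v^N$ solve $$v_t-v_{xx}-N\Phi_x v_x=0\quad\text{in }\mathbb{R}\times(0,\infty)$$ with initial data $v(x,0)$ equal to the characteristic function of $[0,1]$. Then for any $\delta>0$ there are $N_0$ and $T_0$ depending only on $\delta$ such that for all $N>N_0$, $v(x,T_0)<\delta$ for $x\in[0,1]$.
   Formalization: "Solve" is read as: classical for t>0, bounded on finite time intervals, continuous up to t=0 off the jumps, and tending to 0 as |x|→∞ uniformly on bounded time intervals; without this decay bounded solutions are not unique (the diffusion explodes) and the claim fails for some. *)

theory Defs
  imports "HOL-Analysis.Analysis"
begin

definition Phi :: "real \<Rightarrow> real" where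
  "Phi x = (infdist x {0..1}) ^ 3"

text \<open>
  Solutions are written \<open>v x t\<close>; only the values for \<open>t \<ge> 0\<close> matter. The equation holds
  classically for \<open>t > 0\<close>, with \<open>v\<^sub>t\<close>, \<open>v\<^sub>x\<close>, \<open>v\<^sub>x\<^sub>x\<close> existing and jointly continuous there.
\<close>

definition classical_solution :: "real \<Rightarrow> (real \<Rightarrow> real \<Rightarrow> real) \<Rightarrow> bool" where
  "classical_solution N v \<longleftrightarrow>
    (\<exists>vt vx vxx :: real \<Rightarrow> real \<Rightarrow> real.
       (\<forall>x. \<forall>t>0.
          ((\<lambda>s. v x s) has_real_derivative vt x t) (at t) \<and>
          ((\<lambda>y. v y t) has_real_derivative vx x t) (at x) \<and>
          ((\<lambda>y. vx y t) has_real_derivative vxx x t) (at x) \<and>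
          vt x t - vxx x t - N * deriv Phi x * vx x t = 0) \<and>
       continuous_on (UNIV \<times> {0<..}) (\<lambda>(x, t). vt x t) \<and>
       continuous_on (UNIV \<times> {0<..}) (\<lambda>(x, t). vx x t) \<and>
       continuous_on (UNIV \<times> {0<..}) (\<lambda>(x, t). vxx x t))"

text \<open>
  The initial datum is discontinuous at \<open>0\<close> and \<open>1\<close>. It is attained continuously at all other
  points, and \<open>v\<close> is bounded on finite time intervals; without a bound one could add a
  fundamental solution with pole at \<open>(0, 0)\<close> or \<open>(1, 0)\<close>.
\<close>

definition attains_initial_data :: "(real \<Rightarrow> real \<Rightarrow> real) \<Rightarrow> bool" where
  "attains_initial_data v \<longleftrightarrow>
    (\<forall>x. v x 0 = indicator {0..1} x) \<and>
    continuous_on (UNIV \<times> {0..} - {(0, 0), (1, 0)}) (\<lambda>(x, t). v x t) \<and>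
    (\<forall>T>0. bounded ((\<lambda>(x, t). v x t) ` (UNIV \<times> {0..T})))"

text \<open>
  The outward drift \<open>N \<Phi>\<^sub>x\<close> grows quadratically, so the associated diffusion explodes in finite
  time and bounded solutions of the Cauchy problem are not unique: the probability of explosion
  before time \<open>t\<close>, as a function of the starting point, is a nonzero bounded solution with zero
  initial data. The solution meant here is the one vanishing at spatial infinity, locally
  uniformly in time.
\<close>

definition vanishes_at_spatial_infinity :: "(real \<Rightarrow> real \<Rightarrow> real) \<Rightarrow> bool" where
  "vanishes_at_spatial_infinity v \<longleftrightarrow>
    (\<forall>T>0. uniform_limit {0..T} v (\<lambda>_. 0) at_infinity)"

definition solves_cauchy_problem :: "real \<Rightarrow> (real \<Rightarrow> real \<Rightarrow> real) \<Rightarrow> bool" where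
  "solves_cauchy_problem N v \<longleftrightarrow>
    classical_solution N v \<and> attains_initial_data v \<and> vanishes_at_spatial_infinity v"

end

theory Submission
  imports Defs
begin

text \<open>
  The drift \<open>N \<Phi>\<^sub>x\<close> points away from \<open>[0, 1]\<close> and grows quadratically, so the diffusion
  generated by \<open>\<partial>\<^sub>x\<^sub>x + N \<Phi>\<^sub>x \<partial>\<^sub>x\<close> escapes to infinity in a time that is bounded on average,
  uniformly in \<open>N \<ge> 1\<close>. Since \<open>v\<close> vanishes at infinity, it is carried away with the diffusion
  and decays exponentially. Analytically: the bounded function
  \<open>\<phi>(x) = 12 / (12 + (x - 1/2)\<^sup>2)\<close> satisfies \<open>\<phi>'' + N \<Phi>\<^sub>x \<phi>' \<le> - \<phi> / 10\<close> on the whole line for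
  every \<open>N \<ge> 1\<close> (lemma \<open>profile_supersolution\<close>); larger \<open>N\<close> only helps because \<open>\<phi>\<close> decreases
  in the direction of the drift. Hence \<open>2 e\<^bsup>-t/10\<^esup> \<phi>(x)\<close> is a supersolution that
  lies above the initial datum, and comparison gives \<open>v(x, t) \<le> 2 e\<^bsup>-t/10\<^esup>\<close>
  (lemma \<open>exponential_decay\<close>). So any \<open>N\<^sub>0 \<ge> 1\<close> will do, and \<open>T\<^sub>0\<close> only has to make the
  exponential smaller than \<open>\<delta>\<close>.

  The comparison itself (lemma \<open>comparison_principle\<close>) is the maximum principle, with one
  difficulty: \<open>v\<close> is discontinuous at \<open>(0, 0)\<close> and \<open>(1, 0)\<close>. There only the boundedness of \<open>v\<close> is
  available. Heat kernels started slightly before time \<open>0\<close>, centred at \<open>0\<close> and \<open>1\<close> and scaled to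
  have height one there, dominate \<open>v\<close> near these two points after multiplication by a constant;
  they are supersolutions because the drift points away from their centres, and at any fixed
  positive time they tend to zero as their initial width does.
\<close>

section \<open>The drift\<close>

lemma infdist_unit_interval:
  "infdist x {0..1::real} = max 0 (x - 1) + max 0 (- x)"
proof (rule antisym)
  let ?y = "max 0 (min 1 x)"
  have "infdist x {0..1} \<le> dist x ?y"
    by (rule infdist_le) auto
  also have "\<dots> = max 0 (x - 1) + max 0 (- x)"
    by (auto simp: dist_real_def)
  finally show "infdist x {0..1} \<le> max 0 (x - 1) + max 0 (- x)" .
next
  show "max 0 (x - 1) + max 0 (- x) \<le> infdist x {0..1}"
    unfolding infdist_def
    by (auto intro!: cINF_greatest simp: dist_real_def max_def)
qed

lemma Phi_eq: "Phi x = (max 0 (x - 1)) ^ 3 + (max 0 (- x)) ^ 3"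
  unfolding Phi_def infdist_unit_interval by (auto simp: max_def)

lemma has_derivative_pos_part_cube:
  "((\<lambda>y::real. (max 0 y) ^ 3) has_real_derivative 3 * (max 0 x)\<^sup>2) (at x)"
proof -
  consider "x < 0" | "x = 0" | "x > 0" by linarith
  then show ?thesis
  proof cases
    case 1
    have "((\<lambda>y::real. 0) has_real_derivative 3 * (max 0 x)\<^sup>2) (at x)"
      using 1 by simp
    then show ?thesis
      by (rule has_field_derivative_transform_within_open[of _ _ _ "{..<0}"]) (use 1 in auto)
  next
    case 2
    have "((\<lambda>h::real. (max 0 h)\<^sup>2) \<longlongrightarrow> (max 0 0)\<^sup>2) (at 0)"
      by (intro tendsto_intros)
    then have "((\<lambda>h::real. (max 0 h) ^ 3 / h) \<longlongrightarrow> (max 0 0)\<^sup>2) (at 0)"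
      by (rule Lim_transform_eventually)
         (auto simp: eventually_at_filter max_def power2_eq_square power3_eq_cube)
    then show ?thesis
      using 2 by (simp add: DERIV_def)
  next
    case 3
    have "((\<lambda>y::real. y ^ 3) has_real_derivative 3 * (max 0 x)\<^sup>2) (at x)"
      using 3 by (auto intro!: derivative_eq_intros)
    then show ?thesis
      by (rule has_field_derivative_transform_within_open[of _ _ _ "{0<..}"]) (use 3 in auto)
  qed
qed

lemma deriv_Phi: "deriv Phi x = 3 * (max 0 (x - 1))\<^sup>2 - 3 * (max 0 (- x))\<^sup>2"
proof -
  have "((\<lambda>x. (max 0 (x - 1)) ^ 3 + (max 0 (- x)) ^ 3) has_real_derivative
         3 * (max 0 (x - 1))\<^sup>2 * 1 + 3 * (max 0 (- x))\<^sup>2 * (- 1)) (at x)"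
    by (intro DERIV_add DERIV_chain2[OF has_derivative_pos_part_cube])
       (auto intro!: derivative_eq_intros)
  then show ?thesis
    using Phi_eq by (intro DERIV_imp_deriv) (simp add: Phi_eq[abs_def])
qed

text \<open>
  This is all that the Gaussian barriers need from \<open>\<Phi>\<close>: a function decreasing with the distance
  from a point of \<open>[0, 1]\<close> does not increase along the drift.
\<close>
lemma deriv_Phi_outward:
  assumes "p \<in> {0..1}"
  shows "deriv Phi x * (x - p) \<ge> 0"
proof -
  consider "x < 0" | "0 \<le> x" "x \<le> 1" | "x > 1" by linarith
  then show ?thesis
    using assms
    by cases (auto simp: deriv_Phi max_def intro: mult_nonpos_nonpos mult_nonneg_nonneg
        mult_nonpos_nonneg)
qed

lemma deriv_Phi_mult_midpoint:
  "deriv Phi x * (x - 1/2) = 3 * \<bar>x - 1/2\<bar> * (max 0 (\<bar>x - 1/2\<bar> - 1/2))\<^sup>2"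
proof -
  consider "x < 0" | "0 \<le> x" "x \<le> 1" | "x > 1" by linarith
  then show ?thesis
    by cases (auto simp: deriv_Phi max_def abs_if field_simps power2_eq_square)
qed

section \<open>Maximum principle\<close>

lemma second_derivative_nonpos_at_max:
  fixes f f' :: "real \<Rightarrow> real"
  assumes f: "\<And>y. (f has_real_derivative f' y) (at y)"
    and f': "(f' has_real_derivative D) (at x)"
    and max: "\<And>y. f y \<le> f x"
  shows "f' x = 0" "D \<le> 0"
proof -
  show 0: "f' x = 0"
    using DERIV_local_max[OF f, of 1 x] max by auto
  show "D \<le> 0"
  proof (rule ccontr)
    assume "\<not> D \<le> 0"
    then obtain d where d: "d > 0" "\<And>h. 0 < h \<Longrightarrow> h < d \<Longrightarrow> f' x < f' (x + h)"
      using DERIV_pos_inc_right[OF f'] by (metis not_le)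
    have "f x < f (x + d/2)"
    proof (rule DERIV_pos_imp_increasing_open[where f = f])
      show "\<exists>D. (f has_real_derivative D) (at y) \<and> 0 < D" if "x < y" "y < x + d/2" for y
        using d(2)[of "y - x"] that f[of y] 0 d(1) by auto
      show "continuous_on {x..x + d/2} f"
        using f by (meson DERIV_isCont continuous_at_imp_continuous_on)
    qed (use d in auto)
    then show False using max[of "x + d/2"] by simp
  qed
qed

text \<open>
  At a positive maximum over the strip, \<open>h\<^sub>x = 0\<close>, \<open>h\<^sub>x\<^sub>x \<le> 0\<close> and \<open>h\<^sub>t \<ge> 0\<close>, which contradicts the
  strict differential inequality. The compact set \<open>K\<close> serves to make the maximum exist: it can
  omit both a neighbourhood of infinity and neighbourhoods of points where \<open>h\<close> is discontinuous,
  provided that \<open>h \<le> 0\<close> is known there for another reason.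
\<close>
lemma strict_parabolic_maximum_principle:
  fixes h ht hx hxx :: "real \<Rightarrow> real \<Rightarrow> real" and b :: "real \<Rightarrow> real"
  assumes ht: "\<And>x t. t > 0 \<Longrightarrow> ((\<lambda>s. h x s) has_real_derivative ht x t) (at t)"
    and hx: "\<And>x t. t > 0 \<Longrightarrow> ((\<lambda>y. h y t) has_real_derivative hx x t) (at x)"
    and hxx: "\<And>x t. t > 0 \<Longrightarrow> ((\<lambda>y. hx y t) has_real_derivative hxx x t) (at x)"
    and sub: "\<And>x t. t > 0 \<Longrightarrow> ht x t - hxx x t - b x * hx x t < 0"
    and K: "compact K" "K \<subseteq> UNIV \<times> {0..T}" "continuous_on K (\<lambda>(x, t). h x t)"
    and outside: "\<And>x t. t \<in> {0..T} \<Longrightarrow> (x, t) \<notin> K \<Longrightarrow> h x t \<le> 0"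
    and initial: "\<And>x. h x 0 \<le> 0"
    and t: "t \<in> {0..T}"
  shows "h x t \<le> 0"
proof (rule ccontr)
  assume pos: "\<not> h x t \<le> 0"
  then have "(x, t) \<in> K" using outside t by auto
  then obtain z where z: "z \<in> K" "\<And>y. y \<in> K \<Longrightarrow> (\<lambda>(x, t). h x t) y \<le> (\<lambda>(x, t). h x t) z"
    using continuous_attains_sup[OF K(1) _ K(3)] by blast
  obtain a c where ac: "z = (a, c)" by (cases z)
  have hac: "h a c > 0" using z(2)[OF \<open>(x, t) \<in> K\<close>] pos ac by auto
  have c: "0 \<le> c" "c \<le> T" using z(1) K(2) ac by auto
  moreover have "c \<noteq> 0" using initial[of a] hac by auto
  ultimately have c0: "c > 0" by simp
  have max: "h y s \<le> h a c" if "0 \<le> s" "s \<le> T" for y s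
    using outside[of s y] z(2)[of "(y, s)"] that hac ac by fastforce
  have "hx a c = 0" "hxx a c \<le> 0"
    using second_derivative_nonpos_at_max[OF hx[OF c0] hxx[OF c0, of a]] max[OF c] by blast+
  \<comment> \<open>The maximum may lie on the final time slice, so only earlier times are available.\<close>
  moreover have "ht a c \<ge> 0"
  proof (rule ccontr)
    assume "\<not> ht a c \<ge> 0"
    then obtain d where d: "d > 0" "\<And>k. 0 < k \<Longrightarrow> k < d \<Longrightarrow> h a c < h a (c - k)"
      using DERIV_neg_dec_left[OF ht[OF c0, of a]] by (metis not_le)
    define k where "k = min (d/2) c"
    have "0 < k" "k < d" "k \<le> c" using d(1) c0 by (auto simp: k_def)
    then show False
      using d(2)[of k] max[of "c - k" a] c by auto
  qed
  ultimately show False using sub[OF c0, of a] by simp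
qed

section \<open>Gaussian barriers\<close>

text \<open>
  Up to a constant factor, the heat kernel with pole at \<open>(p, - r\<^sup>2)\<close>. The factor \<open>r\<close> normalizes the
  value at \<open>(p, 0)\<close> to one, so that the total mass, and with it the value at each later time,
  tends to zero with \<open>r\<close>.
\<close>
definition gauss_bump :: "real \<Rightarrow> real \<Rightarrow> real \<Rightarrow> real \<Rightarrow> real" where
  "gauss_bump r p x t = r / sqrt (t + r\<^sup>2) * exp (- (x - p)\<^sup>2 / (4 * (t + r\<^sup>2)))"

definition gauss_bump_x :: "real \<Rightarrow> real \<Rightarrow> real \<Rightarrow> real \<Rightarrow> real" where
  "gauss_bump_x r p x t = - (x - p) / (2 * (t + r\<^sup>2)) * gauss_bump r p x t"

definition gauss_bump_t :: "real \<Rightarrow> real \<Rightarrow> real \<Rightarrow> real \<Rightarrow> real" where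
  "gauss_bump_t r p x t =
    ((x - p)\<^sup>2 / (4 * (t + r\<^sup>2)\<^sup>2) - 1 / (2 * (t + r\<^sup>2))) * gauss_bump r p x t"

lemma gauss_bump_center: "r > 0 \<Longrightarrow> gauss_bump r p p 0 = 1"
  by (simp add: gauss_bump_def)

lemma gauss_bump_nonneg: "r > 0 \<Longrightarrow> t \<ge> 0 \<Longrightarrow> gauss_bump r p x t \<ge> 0"
  by (simp add: gauss_bump_def)

lemma gauss_bump_deriv_x:
  assumes "r > 0" "t > 0"
  shows "((\<lambda>y. gauss_bump r p y t) has_real_derivative gauss_bump_x r p x t) (at x)"
proof -
  define s where "s = t + r\<^sup>2"
  define c where "c = r / sqrt s"
  have s: "s > 0" using assms by (simp add: s_def add_pos_pos)
  have "((\<lambda>y. c * exp (- (y - p)\<^sup>2 / (4 * s))) has_real_derivative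
      - (x - p) / (2 * s) * (c * exp (- (x - p)\<^sup>2 / (4 * s)))) (at x)"
    using s by (auto intro!: derivative_eq_intros simp: divide_simps) (simp add: algebra_simps)
  then show ?thesis
    by (simp add: gauss_bump_def gauss_bump_x_def s_def c_def)
qed

text \<open>
  The second space derivative is the time derivative \<open>gauss_bump_t\<close>: this is the heat equation.
\<close>
lemma gauss_bump_deriv_xx:
  assumes "r > 0" "t > 0"
  shows "((\<lambda>y. gauss_bump_x r p y t) has_real_derivative gauss_bump_t r p x t) (at x)"
proof -
  define s where "s = t + r\<^sup>2"
  have s: "s > 0" using assms by (simp add: s_def add_pos_pos)
  have "((\<lambda>y. - (y - p) / (2 * s) * gauss_bump r p y t) has_real_derivative
      (- 1 / (2 * s) * gauss_bump r p x t + gauss_bump_x r p x t * (- (x - p) / (2 * s)))) (at x)"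
    using s by (auto intro!: derivative_eq_intros gauss_bump_deriv_x assms)
       (simp add: field_simps)
  moreover have "- 1 / (2 * s) * G + - (x - p) / (2 * s) * G * (- (x - p) / (2 * s)) =
      ((x - p)\<^sup>2 / (4 * s\<^sup>2) - 1 / (2 * s)) * G" for G
    using s by (simp add: divide_simps) (simp add: algebra_simps power2_eq_square)
  ultimately show ?thesis
    by (simp add: gauss_bump_x_def gauss_bump_t_def s_def[symmetric])
qed

lemma gauss_bump_deriv_t:
  assumes "r > 0" "t > 0"
  shows "((\<lambda>s. gauss_bump r p x s) has_real_derivative gauss_bump_t r p x t) (at t)"
proof -
  define S where "S = sqrt (t + r\<^sup>2)"
  have s: "t + r\<^sup>2 > 0" using assms by (simp add: add_pos_pos)
  then have S: "S > 0" "t + r\<^sup>2 = S\<^sup>2" by (auto simp: S_def)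
  then have sqrt_S: "sqrt (S\<^sup>2) = S" by simp
  have root: "((\<lambda>s. sqrt (s + r\<^sup>2)) has_real_derivative inverse S / 2 * 1) (at t)"
    unfolding S_def
    by (rule DERIV_chain2[where f = sqrt and g = "\<lambda>s. s + r\<^sup>2"])
       (use DERIV_real_sqrt[OF s] in \<open>auto intro!: derivative_eq_intros\<close>)
  have inv: "((\<lambda>s. inverse (sqrt (s + r\<^sup>2))) has_real_derivative
      - (inverse S * (inverse S / 2) * inverse S)) (at t)"
    using DERIV_inverse'[OF root] S(1) unfolding S_def[symmetric] by simp
  have "((\<lambda>s. inverse (s + r\<^sup>2)) has_real_derivative
      - (inverse (S\<^sup>2) * inverse (S\<^sup>2))) (at t)"
    using S by (auto intro!: derivative_eq_intros)
  then have exp: "((\<lambda>s. exp (- (x - p)\<^sup>2 / 4 * inverse (s + r\<^sup>2))) has_real_derivative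
      exp (- (x - p)\<^sup>2 / 4 * inverse (S\<^sup>2))
        * (- (x - p)\<^sup>2 / 4 * (- (inverse (S\<^sup>2) * inverse (S\<^sup>2))))) (at t)"
    unfolding S(2)[symmetric] by (intro DERIV_fun_exp DERIV_cmult)
  have "((\<lambda>s. r * inverse (sqrt (s + r\<^sup>2)) * exp (- (x - p)\<^sup>2 / 4 * inverse (s + r\<^sup>2)))
      has_real_derivative
      r * (- (inverse S * (inverse S / 2) * inverse S)) * exp (- (x - p)\<^sup>2 / 4 * inverse (S\<^sup>2))
      + exp (- (x - p)\<^sup>2 / 4 * inverse (S\<^sup>2))
          * (- (x - p)\<^sup>2 / 4 * (- (inverse (S\<^sup>2) * inverse (S\<^sup>2)))) * (r * inverse S)) (at t)"
    using DERIV_mult[OF DERIV_cmult[OF inv, of r] exp] unfolding S(2) sqrt_S .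
  moreover have bump: "gauss_bump r p x s =
      r * inverse (sqrt (s + r\<^sup>2)) * exp (- (x - p)\<^sup>2 / 4 * inverse (s + r\<^sup>2))" for s
    by (simp add: gauss_bump_def inverse_eq_divide)
  moreover have "(y / (4 * (S\<^sup>2)\<^sup>2) - 1 / (2 * S\<^sup>2)) * (r * inverse S * e) =
      r * (- (inverse S * (inverse S / 2) * inverse S)) * e
      + e * (- y / 4 * (- (inverse (S\<^sup>2) * inverse (S\<^sup>2)))) * (r * inverse S)" for y e
    using S(1) by (simp add: divide_simps power2_eq_square) (simp add: algebra_simps)
  then have "gauss_bump_t r p x t =
      r * (- (inverse S * (inverse S / 2) * inverse S)) * exp (- (x - p)\<^sup>2 / 4 * inverse (S\<^sup>2))
      + exp (- (x - p)\<^sup>2 / 4 * inverse (S\<^sup>2))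
          * (- (x - p)\<^sup>2 / 4 * (- (inverse (S\<^sup>2) * inverse (S\<^sup>2)))) * (r * inverse S)"
    unfolding gauss_bump_t_def bump S(2) sqrt_S .
  ultimately show ?thesis by (simp only:)
qed

lemma continuous_on_gauss_bump:
  assumes "r > 0"
  shows "continuous_on (UNIV \<times> {- (r\<^sup>2)<..}) (\<lambda>(x, t). gauss_bump r p x t)"
  unfolding gauss_bump_def split_def
  by (intro continuous_intros) (auto simp: eq_neg_iff_add_eq_0[symmetric])

lemma gauss_bump_large_near_center:
  assumes "r > 0"
  obtains U where "open U" "(p, 0) \<in> U"
    "\<And>x t. (x, t) \<in> U \<Longrightarrow> gauss_bump r p x t > 1/2"
proof -
  let ?A = "UNIV \<times> {- (r\<^sup>2)<..} :: (real \<times> real) set"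
  have "open ?A" by (intro open_Times) auto
  then have "open ((\<lambda>(x, t). gauss_bump r p x t) -` {1/2<..} \<inter> ?A)"
    by (intro continuous_on_open_vimage[THEN iffD1, rule_format]
        continuous_on_gauss_bump assms) auto
  then show ?thesis
    by (rule that) (use assms gauss_bump_center[of r p] in auto)
qed

lemma gauss_bump_tendsto_0:
  assumes "t > 0"
  shows "((\<lambda>r. gauss_bump r p x t) \<longlongrightarrow> 0) (at_right 0)"
proof -
  have "((\<lambda>r. gauss_bump r p x t) \<longlongrightarrow>
      0 / sqrt (t + 0\<^sup>2) * exp (- (x - p)\<^sup>2 / (4 * (t + 0\<^sup>2)))) (at_right 0)"
    unfolding gauss_bump_def using assms by (intro tendsto_intros) auto
  then show ?thesis by simp
qed

lemma gauss_bump_drift: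
  assumes "r > 0" "t > 0" "p \<in> {0..1}"
  shows "deriv Phi x * gauss_bump_x r p x t \<le> 0"
proof -
  have "deriv Phi x * gauss_bump_x r p x t =
      - (deriv Phi x * (x - p)) * (gauss_bump r p x t / (2 * (t + r\<^sup>2)))"
    using assms by (simp add: gauss_bump_x_def divide_simps) (simp add: algebra_simps)
  also have "\<dots> \<le> 0"
    by (rule mult_nonpos_nonneg)
       (use assms deriv_Phi_outward[of p x] gauss_bump_nonneg[of r t p x] in auto)
  finally show ?thesis .
qed

section \<open>Comparison with supersolutions\<close>

text \<open>
  The maximum principle is applied to \<open>v\<close> minus \<open>w\<close>, minus the two Gaussian bumps times \<open>2 B\<close>,
  where \<open>B\<close> bounds \<open>\<bar>v\<bar>\<close>, minus \<open>r (1 + t)\<close>. Near each of the two discontinuities one of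
  the bumps exceeds one half and makes the difference negative there. The term \<open>r\<close> makes it
  negative far out in space, where \<open>v < r\<close>, and the term \<open>r t\<close> makes the differential inequality strict. Then
  \<open>r\<close> tends to zero.
\<close>
lemma comparison_principle:
  fixes v w wt wx wxx :: "real \<Rightarrow> real \<Rightarrow> real"
  assumes v: "solves_cauchy_problem N v" and N: "N > 0"
    and wt: "\<And>x t. t > 0 \<Longrightarrow> ((\<lambda>s. w x s) has_real_derivative wt x t) (at t)"
    and wx: "\<And>x t. t > 0 \<Longrightarrow> ((\<lambda>y. w y t) has_real_derivative wx x t) (at x)"
    and wxx: "\<And>x t. t > 0 \<Longrightarrow> ((\<lambda>y. wx y t) has_real_derivative wxx x t) (at x)"
    and super: "\<And>x t. t > 0 \<Longrightarrow> wt x t - wxx x t - N * deriv Phi x * wx x t \<ge> 0"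
    and cont: "continuous_on (UNIV \<times> {0..}) (\<lambda>(x, t). w x t)"
    and nonneg: "\<And>x t. t \<ge> 0 \<Longrightarrow> w x t \<ge> 0"
    and initial: "\<And>x. x \<in> {0..1} \<Longrightarrow> w x 0 \<ge> 1"
    and T: "T > 0"
  shows "v x T \<le> w x T"
proof -
  obtain vt vx vxx where
    vt: "\<And>x t. t > 0 \<Longrightarrow> ((\<lambda>s. v x s) has_real_derivative vt x t) (at t)" and
    vx: "\<And>x t. t > 0 \<Longrightarrow> ((\<lambda>y. v y t) has_real_derivative vx x t) (at x)" and
    vxx: "\<And>x t. t > 0 \<Longrightarrow> ((\<lambda>y. vx y t) has_real_derivative vxx x t) (at x)" and
    eq: "\<And>x t. t > 0 \<Longrightarrow> vt x t - vxx x t - N * deriv Phi x * vx x t = 0"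
    using v unfolding solves_cauchy_problem_def classical_solution_def by blast
  have v0: "\<And>x. v x 0 = indicator {0..1} x"
    and vcont: "continuous_on (UNIV \<times> {0..} - {(0, 0), (1, 0)}) (\<lambda>(x, t). v x t)"
    and vbd: "bounded ((\<lambda>(x, t). v x t) ` (UNIV \<times> {0..T}))"
    and vlim: "uniform_limit {0..T} v (\<lambda>_. 0) at_infinity"
    using v T unfolding solves_cauchy_problem_def attains_initial_data_def
      vanishes_at_spatial_infinity_def by blast+
  obtain B where B: "B > 0" "\<And>x t. t \<in> {0..T} \<Longrightarrow> \<bar>v x t\<bar> \<le> B"
    using vbd unfolding bounded_pos by fastforce
  \<comment> \<open>One parameter \<open>r\<close> serves both as width of the bumps and as size of the strict term.\<close>
  have bound: "v x T \<le> w x T + 2 * B * (gauss_bump r 0 x T + gauss_bump r 1 x T) + r * (1 + T)"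
    if r: "r > 0" for r
  proof -
    define h where "h x t = v x t - (w x t
      + 2 * B * (gauss_bump r 0 x t + gauss_bump r 1 x t) + r * (1 + t))" for x t
    define ht where "ht x t = vt x t - (wt x t
      + 2 * B * (gauss_bump_t r 0 x t + gauss_bump_t r 1 x t) + r)" for x t
    define hx where "hx x t = vx x t - (wx x t
      + 2 * B * (gauss_bump_x r 0 x t + gauss_bump_x r 1 x t))" for x t
    define hxx where "hxx x t = vxx x t - (wxx x t
      + 2 * B * (gauss_bump_t r 0 x t + gauss_bump_t r 1 x t))" for x t
    obtain U0 where U0: "open U0" "(0, 0) \<in> U0" 
        "\<And>x t. (x, t) \<in> U0 \<Longrightarrow> gauss_bump r 0 x t > 1/2"
      using gauss_bump_large_near_center[OF r, of 0] by blast
    obtain U1 where U1: "open U1" "(1, 0) \<in> U1"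
        "\<And>x t. (x, t) \<in> U1 \<Longrightarrow> gauss_bump r 1 x t > 1/2"
      using gauss_bump_large_near_center[OF r, of 1] by blast
    obtain R where R: "\<And>x t. R \<le> \<bar>x\<bar> \<Longrightarrow> t \<in> {0..T} \<Longrightarrow> \<bar>v x t\<bar> < r"
      using uniform_limitD[OF vlim r] unfolding eventually_at_infinity
      by (force simp: dist_real_def)
    define K where "K = ({-R..R} \<times> {0..T}) - U0 - U1"
    have bumps: "gauss_bump r p x t \<ge> 0" if "t \<ge> 0" for p x t
      using gauss_bump_nonneg[OF r that] .
    have "h x T \<le> 0"
    proof (rule strict_parabolic_maximum_principle
        [of h ht hx hxx "\<lambda>x. N * deriv Phi x" K T T x])
      fix x t :: real assume t: "t > 0"
      show "((\<lambda>s. h x s) has_real_derivative ht x t) (at t)"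
        unfolding h_def ht_def
        by (auto intro!: derivative_eq_intros vt wt gauss_bump_deriv_t r t)
      show "((\<lambda>y. h y t) has_real_derivative hx x t) (at x)"
        unfolding h_def hx_def
        by (auto intro!: derivative_eq_intros vx wx gauss_bump_deriv_x r t)
      show "((\<lambda>y. hx y t) has_real_derivative hxx x t) (at x)"
        unfolding hx_def hxx_def
        by (auto intro!: derivative_eq_intros vxx wxx gauss_bump_deriv_xx r t)
      have "deriv Phi x * gauss_bump_x r 0 x t + deriv Phi x * gauss_bump_x r 1 x t \<le> 0"
        using gauss_bump_drift[OF r t, of 0 x] gauss_bump_drift[OF r t, of 1 x] by simp
      then have "2 * B * N * (deriv Phi x * gauss_bump_x r 0 x t
          + deriv Phi x * gauss_bump_x r 1 x t) \<le> 0"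
        using B(1) N by (intro mult_nonneg_nonpos) auto
      moreover have "ht x t - hxx x t - N * deriv Phi x * hx x t =
          (vt x t - vxx x t - N * deriv Phi x * vx x t)
          - (wt x t - wxx x t - N * deriv Phi x * wx x t) - r
          + 2 * B * N * (deriv Phi x * gauss_bump_x r 0 x t
            + deriv Phi x * gauss_bump_x r 1 x t)"
        by (simp add: ht_def hxx_def hx_def algebra_simps)
      ultimately show "ht x t - hxx x t - N * deriv Phi x * hx x t < 0"
        using eq[OF t, of x] super[OF t, of x] r by linarith
    next
      show "compact K"
        unfolding K_def by (intro compact_diff compact_Times U0 U1) auto
      show "K \<subseteq> UNIV \<times> {0..T}" by (auto simp: K_def)
      have "continuous_on K (\<lambda>(x, t). v x t)"
        by (rule continuous_on_subset[OF vcont]) (use U0(2) U1(2) in \<open>auto simp: K_def\<close>)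
      moreover have "continuous_on K (\<lambda>(x, t). w x t)"
        by (rule continuous_on_subset[OF cont]) (auto simp: K_def)
      moreover have "continuous_on K (\<lambda>(x, t). gauss_bump r p x t)" for p
      proof (rule continuous_on_subset[OF continuous_on_gauss_bump[OF r]])
        have "- (r\<^sup>2) < 0" using r by simp
        then show "K \<subseteq> UNIV \<times> {- (r\<^sup>2)<..}"
          by (auto simp: K_def simp del: neg_less_0_iff_less)
      qed
      ultimately show "continuous_on K (\<lambda>(x, t). h x t)"
        unfolding h_def split_def by (intro continuous_intros) auto
    next
      fix x t :: real assume t: "t \<in> {0..T}" and out: "(x, t) \<notin> K"
      have rt: "r * (1 + t) \<ge> r" using r t by auto
      have w: "w x t \<ge> 0" using nonneg t by auto
      have g: "gauss_bump r 0 x t \<ge> 0" "gauss_bump r 1 x t \<ge> 0" using bumps t by auto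
      then have g': "2 * B * (gauss_bump r 0 x t + gauss_bump r 1 x t) \<ge> 0"
        using B(1) by simp
      consider "\<bar>x\<bar> \<ge> R" | "(x, t) \<in> U0 \<union> U1" using out t by (force simp: K_def)
      then show "h x t \<le> 0"
      proof cases
        case 1
        show ?thesis using R[OF 1 t] rt w g' by (simp add: h_def)
      next
        case 2
        then have "gauss_bump r 0 x t + gauss_bump r 1 x t \<ge> 1/2"
          using U0(3)[of x t] U1(3)[of x t] g by auto
        then have "2 * B * (gauss_bump r 0 x t + gauss_bump r 1 x t) \<ge> 2 * B * (1/2)"
          using B(1) by (intro mult_left_mono) auto
        then show ?thesis using B(2)[OF t, of x] rt w r unfolding h_def by linarith
      qed
    next
      fix x :: real
      have "2 * B * (gauss_bump r 0 x 0 + gauss_bump r 1 x 0) \<ge> 0"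
        using B(1) bumps by simp
      moreover have "v x 0 \<le> w x 0"
        using v0[of x] initial[of x] nonneg[of 0 x] by (auto simp: indicator_def)
      ultimately show "h x 0 \<le> 0" using r by (simp add: h_def)
    next
      show "T \<in> {0..T}" using T by simp
    qed
    then show ?thesis by (simp add: h_def)
  qed
  have "((\<lambda>r. w x T + 2 * B * (gauss_bump r 0 x T + gauss_bump r 1 x T) + r * (1 + T))
      \<longlongrightarrow> w x T + 2 * B * (0 + 0) + 0 * (1 + T)) (at_right 0)"
    by (intro tendsto_intros gauss_bump_tendsto_0 T)
  moreover have "\<forall>\<^sub>F r in at_right 0.
      v x T \<le> w x T + 2 * B * (gauss_bump r 0 x T + gauss_bump r 1 x T) + r * (1 + T)"
    using bound by (auto simp: eventually_at_right_field intro!: exI[of _ 1])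
  ultimately have "v x T \<le> w x T + 2 * B * (0 + 0) + 0 * (1 + T)"
    by (rule tendsto_lowerbound) simp
  then show ?thesis by simp
qed

section \<open>The decaying supersolution\<close>

text \<open>
  The requirements on the profile are a definite amount of concavity on \<open>[0, 1]\<close>, where there is no
  drift, and slow decay outside, where the drift term \<open>\<Phi>\<^sub>x \<phi>'\<close> has to dominate both \<open>\<phi>\<close> and the
  positive part of \<open>\<phi>''\<close>; a power decay suffices because \<open>\<Phi>\<^sub>x\<close> grows quadratically. With the
  constant \<open>12\<close> the profile is concave for \<open>\<bar>x - 1/2\<bar> \<le> 2\<close>, so that the drift has become large
  before the concavity is lost.
\<close>
definition profile :: "real \<Rightarrow> real" where
  "profile x = 12 / (12 + (x - 1/2)\<^sup>2)"

definition profile' :: "real \<Rightarrow> real" where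
  "profile' x = - 24 * (x - 1/2) / (12 + (x - 1/2)\<^sup>2)\<^sup>2"

definition profile'' :: "real \<Rightarrow> real" where
  "profile'' x = (72 * (x - 1/2)\<^sup>2 - 288) / (12 + (x - 1/2)\<^sup>2) ^ 3"

lemma profile_deriv: "(profile has_real_derivative profile' x) (at x)"
proof -
  have "12 + (x - 1/2)\<^sup>2 > 0" by (intro add_pos_nonneg) auto
  then show ?thesis
    unfolding profile_def profile'_def
    by (auto intro!: derivative_eq_intros simp: power2_eq_square)
qed

lemma profile'_deriv: "(profile' has_real_derivative profile'' x) (at x)"
proof -
  define q where "q = 12 + (x - 1/2)\<^sup>2"
  have q: "q > 0" unfolding q_def by (intro add_pos_nonneg) auto
  have "(profile' has_real_derivative
      ((- 24) * q\<^sup>2 - (- 24 * (x - 1/2)) * (2 * q * (2 * (x - 1/2)))) / (q\<^sup>2 * q\<^sup>2)) (at x)"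
    unfolding profile'_def using q
    by (auto intro!: derivative_eq_intros simp: q_def[symmetric])
  moreover have "((- 24) * q\<^sup>2 - (- 24 * y) * (2 * q * (2 * y))) / (q\<^sup>2 * q\<^sup>2)
      = (- 24 * q + 96 * y\<^sup>2) / q ^ 3" for y
    using q by (simp add: divide_simps eval_nat_numeral) (simp add: algebra_simps)
  moreover have "(- 24 * q + 96 * (x - 1/2)\<^sup>2) / q ^ 3 = profile'' x"
    by (simp add: profile''_def q_def)
  ultimately show ?thesis by metis
qed

lemma profile_bounds:
  "0 \<le> profile x" "profile x \<le> 1" "x \<in> {0..1} \<Longrightarrow> 1/2 \<le> profile x"
proof -
  have q: "12 + (x - 1/2)\<^sup>2 > 0" by (intro add_pos_nonneg) auto
  then show "0 \<le> profile x" "profile x \<le> 1" by (auto simp: profile_def)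
  assume "x \<in> {0..1}"
  then have "\<bar>x - 1/2\<bar> \<le> 1" by auto
  then have "(x - 1/2)\<^sup>2 \<le> 1" using abs_square_le_1 by blast
  then show "1/2 \<le> profile x" using q by (simp add: profile_def field_simps)
qed

text \<open>
  The inequality \<open>\<phi>'' + \<Phi>\<^sub>x \<phi>' + \<phi> / 10 \<le> 0\<close> multiplied by \<open>(12 + s\<^sup>2)\<^sup>3\<close>, with \<open>s = \<bar>x - 1/2\<bar>\<close>.
  For \<open>s \<le> 1\<close> concavity alone gives it; for \<open>s \<ge> 1\<close> the drift term is large enough, by the
  crude bounds \<open>s - 1/2 \<ge> s / 2\<close> and \<open>s \<ge> 1\<close>.
\<close>
lemma profile_polynomial_inequality:
  fixes s :: real
  assumes "s \<ge> 0"
  shows "72 * s\<^sup>2 - 288 + 6/5 * (12 + s\<^sup>2)\<^sup>2 \<le> 72 * (s * (max 0 (s - 1/2))\<^sup>2) * (12 + s\<^sup>2)"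
proof (cases "s \<le> 1")
  case True
  then have "s\<^sup>2 \<le> 1" using assms by (simp add: power_le_one)
  then have "s\<^sup>2 * s\<^sup>2 \<le> 1" using mult_le_one[of "s\<^sup>2" "s\<^sup>2"] by simp
  then have "72 * s\<^sup>2 - 288 + 6/5 * (12 + s\<^sup>2)\<^sup>2 \<le> 0"
    using \<open>s\<^sup>2 \<le> 1\<close> by (simp add: power2_eq_square[of "12 + s\<^sup>2"] algebra_simps)
  also have "0 \<le> 72 * (s * (max 0 (s - 1/2))\<^sup>2) * (12 + s\<^sup>2)" using assms by simp
  finally show ?thesis .
next
  case False
  have "(s / 2)\<^sup>2 \<le> (max 0 (s - 1/2))\<^sup>2" using False by (intro power_mono) auto
  then have "1 * (s / 2)\<^sup>2 \<le> s * (max 0 (s - 1/2))\<^sup>2" using False by (intro mult_mono) auto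
  then have "72 * (s\<^sup>2 / 4) * (12 + s\<^sup>2) \<le> 72 * (s * (max 0 (s - 1/2))\<^sup>2) * (12 + s\<^sup>2)"
    by (intro mult_right_mono) (auto simp: power_divide)
  moreover have "72 * s\<^sup>2 - 288 + 6/5 * (12 + s\<^sup>2)\<^sup>2 \<le> 72 * (s\<^sup>2 / 4) * (12 + s\<^sup>2)"
  proof -
    have "72 * s\<^sup>2 - 288 + 6/5 * (12 + s\<^sup>2)\<^sup>2 = 6/5 * s ^ 4 + 504/5 * s\<^sup>2 - 576/5"
      "72 * (s\<^sup>2 / 4) * (12 + s\<^sup>2) = 18 * s ^ 4 + 216 * s\<^sup>2"
      by (simp_all add: power2_sum power2_eq_square power4_eq_xxxx field_simps)
    moreover have "s ^ 4 \<ge> 0" "s\<^sup>2 \<ge> 0" by simp_all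
    ultimately show ?thesis by linarith
  qed
  ultimately show ?thesis by linarith
qed

lemma profile_supersolution:
  assumes "N \<ge> 1"
  shows "profile'' x + N * deriv Phi x * profile' x \<le> - profile x / 10"
proof -
  define s where "s = x - 1/2"
  define m where "m = \<bar>s\<bar> * (max 0 (\<bar>s\<bar> - 1/2))\<^sup>2"
  define q where "q = 12 + s\<^sup>2"
  have q: "q > 0" unfolding q_def by (intro add_pos_nonneg) auto
  have ds: "deriv Phi x * s = 3 * m"
    using deriv_Phi_mult_midpoint[of x] by (simp add: s_def m_def)
  have m: "m \<ge> 0" by (simp add: m_def)
  \<comment> \<open>The drift term has the favourable sign, which reduces the claim to \<open>N = 1\<close>.\<close>
  have "1 * m \<le> N * m" using assms m by (rule mult_right_mono)
  have "72 * s\<^sup>2 - 288 + 6/5 * q\<^sup>2 \<le> 72 * m * q"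
    using profile_polynomial_inequality[of "\<bar>s\<bar>"] by (simp add: m_def q_def)
  also have "\<dots> \<le> 72 * (N * m) * q"
    using \<open>1 * m \<le> N * m\<close> q by (intro mult_right_mono) auto
  finally have "(72 * s\<^sup>2 - 288 + 6/5 * q\<^sup>2 - 72 * (N * m) * q) / q ^ 3 \<le> 0"
    using q by (intro divide_nonpos_pos) auto
  moreover have "N * deriv Phi x * profile' x = - 24 * N * (deriv Phi x * s) / q\<^sup>2"
    by (simp add: profile'_def flip: s_def q_def)
  then have drift: "N * deriv Phi x * profile' x = - 72 * (N * m) / q\<^sup>2"
    by (simp add: ds)
  have "profile'' x + N * deriv Phi x * profile' x + profile x / 10
      = (72 * s\<^sup>2 - 288 + 6/5 * q\<^sup>2 - 72 * (N * m) * q) / q ^ 3"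
    using q unfolding drift profile''_def profile_def s_def[symmetric] q_def[symmetric]
    by (simp add: divide_simps) (simp add: algebra_simps eval_nat_numeral)
  ultimately show ?thesis by linarith
qed

text \<open>
  The factor \<open>2\<close> compensates for the profile, which on \<open>[0, 1]\<close> is only known to be at least one
  half, so that the supersolution starts above the initial datum.
\<close>
lemma exponential_decay:
  assumes v: "solves_cauchy_problem N v" and N: "N \<ge> 1" and T: "T > 0"
  shows "v x T \<le> 2 * exp (- T / 10)"
proof -
  have "v x T \<le> 2 * exp (- T / 10) * profile x"
  proof (rule comparison_principle[OF v, where w = "\<lambda>x t. 2 * exp (- t / 10) * profile x"
        and wt = "\<lambda>x t. - (1 / 5) * exp (- t / 10) * profile x"
        and wx = "\<lambda>x t. 2 * exp (- t / 10) * profile' x"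
        and wxx = "\<lambda>x t. 2 * exp (- t / 10) * profile'' x"])
    fix x t :: real assume "t > 0"
    show "((\<lambda>s. 2 * exp (- s / 10) * profile x) has_real_derivative
        - (1 / 5) * exp (- t / 10) * profile x) (at t)"
      by (auto intro!: derivative_eq_intros)
    show "((\<lambda>y. 2 * exp (- t / 10) * profile y) has_real_derivative
        2 * exp (- t / 10) * profile' x) (at x)"
      by (auto intro!: derivative_eq_intros profile_deriv)
    show "((\<lambda>y. 2 * exp (- t / 10) * profile' y) has_real_derivative
        2 * exp (- t / 10) * profile'' x) (at x)"
      by (auto intro!: derivative_eq_intros profile'_deriv)
    have "2 * exp (- t / 10) * (- profile x / 10 - (profile'' x + N * deriv Phi x * profile' x)) \<ge> 0"
      using profile_supersolution[OF N, of x] by (intro mult_nonneg_nonneg) auto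
    then show "- (1 / 5) * exp (- t / 10) * profile x - 2 * exp (- t / 10) * profile'' x
        - N * deriv Phi x * (2 * exp (- t / 10) * profile' x) \<ge> 0"
      by (simp add: algebra_simps)
  next
    have "continuous_on UNIV profile"
      using profile_deriv by (meson DERIV_isCont continuous_at_imp_continuous_on)
    then show "continuous_on (UNIV \<times> {0..}) (\<lambda>(x, t). 2 * exp (- t / 10) * profile x)"
      unfolding split_def
      by (intro continuous_intros continuous_on_compose2[of UNIV profile _ fst]) auto
  qed (use N T profile_bounds in \<open>force+\<close>)
  also have "\<dots> \<le> 2 * exp (- T / 10)"
    using profile_bounds(2)[of x] by (simp add: mult_left_le)
  finally show ?thesis .
qed

theorem theorem5p1:
  fixes \<delta> :: real
  assumes "\<delta> > 0"
  shows "\<exists>N0>0. \<exists>T0>0. \<forall>N>N0. \<forall>v. solves_cauchy_problem N v \<longrightarrow>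
           (\<forall>x\<in>{0..1}. v x T0 < \<delta>)"
proof -
  define T where "T = max 1 (10 * ln (4 / \<delta>))"
  have T: "T > 0" by (simp add: T_def)
  have "exp (- T / 10) \<le> exp (- ln (4 / \<delta>))" by (simp add: T_def)
  also have "\<dots> = \<delta> / 4" using assms by (simp add: exp_minus)
  finally have "2 * exp (- T / 10) < \<delta>" using assms by linarith
  then have "\<forall>N>1. \<forall>v. solves_cauchy_problem N v \<longrightarrow> (\<forall>x\<in>{0..1}. v x T < \<delta>)"
    using exponential_decay T by (smt (verit))
  then show ?thesis using T by (intro exI[of _ 1] conjI exI[of _ T]) auto
qed

end
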